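(* Let $G$ be a finite group with $\mathcal{S}=\{1\}$, and let $C=[y]_{\mathtt{N}}$ (with $y\in G$) be a critical class of $\mathcal{P}(G)$. Then $C$ is of plain type if and only if there exists $x\in G\setminus\hat{C}$ such that $|[x]_{\mathtt{N}}|\leq |C|$ and $\{x,y\}\in E$.
   Context: For a finite group $G$, the power graph $\mathcal{P}(G)=(G,E)$ has vertex set $G$, and distinct $x,y$ are adjacent ($\{x,y\}\in E$) iff $x=y^m$ or $y=x^m$ for some positive integer $m$. $N[x]=\{y\in G:\{x,y\}\in E\}\cup\{x\}$ is the closed neighbourhood of $x$, and $\mathcal{S}=\{x\in G: N[x]=G\}$ is the set of star vertices. Write $x\,\mathtt{N}\,y$ if $N[x]=N[y]$; this is an equivalence relation, $[x]_{\mathtt{N}}$ denotes the class of $x$, and its classes are called $\mathtt{N}$-classes. Write $x\diamond y$ if $\langle x\rangle=\langle y\rangle$; its classes are called $\diamond$-classes. Every $\mathtt{N}$-class is a union of $\diamond$-classes; an $\mathtt{N}$-class is of plain type if it is a single $\diamond$-class, and of compound type if it is the union of at least two $\diamond$-classes. For $X\subseteq G$, $N[X]=\bigcap_{x\in X}N[x]$ if $X\ne\varnothing$, $N[\varnothing]=G$, and $\hat{X}=N[N[X]]$. A critical class is an $\mathtt{N}$-class $C$ such that $1\notin C$, $\hat{C}=C\cup\{1\}$, and $|\hat{C}|=p^r$ for some prime $p$ and some integer $r\geq 2$. *)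

theory Defs
  imports "HOL-Algebra.Generated_Groups" "HOL-Computational_Algebra.Primes"
begin

definition power_graph_edges :: "('a, 'b) monoid_scheme \<Rightarrow> 'a set set" where
  "power_graph_edges G =
    {{x, y} | x y. x \<in> carrier G \<and> y \<in> carrier G \<and> x \<noteq> y \<and>
       (\<exists>m::nat. m > 0 \<and> (x = y [^]\<^bsub>G\<^esub> m \<or> y = x [^]\<^bsub>G\<^esub> m))}"

definition closed_nbhd :: "('a, 'b) monoid_scheme \<Rightarrow> 'a \<Rightarrow> 'a set" where
  "closed_nbhd G x = {y \<in> carrier G. {x, y} \<in> power_graph_edges G} \<union> {x}"

definition star_vertices :: "('a, 'b) monoid_scheme \<Rightarrow> 'a set" where
  "star_vertices G = {x \<in> carrier G. closed_nbhd G x = carrier G}"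

definition N_rel :: "('a, 'b) monoid_scheme \<Rightarrow> ('a \<times> 'a) set" where
  "N_rel G = {(x, y). x \<in> carrier G \<and> y \<in> carrier G \<and> closed_nbhd G x = closed_nbhd G y}"

definition diamond_rel :: "('a, 'b) monoid_scheme \<Rightarrow> ('a \<times> 'a) set" where
  "diamond_rel G = {(x, y). x \<in> carrier G \<and> y \<in> carrier G \<and> generate G {x} = generate G {y}}"

definition N_class :: "('a, 'b) monoid_scheme \<Rightarrow> 'a \<Rightarrow> 'a set" where
  "N_class G x = N_rel G `` {x}"

definition plain_type :: "('a, 'b) monoid_scheme \<Rightarrow> 'a set \<Rightarrow> bool" where
  "plain_type G C \<longleftrightarrow> C \<in> carrier G // N_rel G \<and> C \<in> carrier G // diamond_rel G"

definition common_closed_nbhd :: "('a, 'b) monoid_scheme \<Rightarrow> 'a set \<Rightarrow> 'a set" where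
  "common_closed_nbhd G X = (if X = {} then carrier G else (\<Inter>x\<in>X. closed_nbhd G x))"

definition nbhd_closure :: "('a, 'b) monoid_scheme \<Rightarrow> 'a set \<Rightarrow> 'a set" where
  "nbhd_closure G X = common_closed_nbhd G (common_closed_nbhd G X)"

definition critical_class :: "('a, 'b) monoid_scheme \<Rightarrow> 'a set \<Rightarrow> bool" where
  "critical_class G C \<longleftrightarrow>
     C \<in> carrier G // N_rel G \<and> \<one>\<^bsub>G\<^esub> \<notin> C \<and>
     nbhd_closure G C = C \<union> {\<one>\<^bsub>G\<^esub>} \<and>
     (\<exists>(p::nat) (r::nat). Factorial_Ring.prime p \<and> r \<ge> 2 \<and> card (nbhd_closure G C) = p ^ r)"

end

theory Submission
  imports Defs "HOL-Algebra.Multiplicative_Group" "HOL-Number_Theory.Totient"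
begin

text \<open>
  In a finite group, \<open>z\<close> lies in the closed neighbourhood of \<open>x\<close> iff one of \<open>x\<close>, \<open>z\<close> lies in the
  cyclic subgroup generated by the other; inside one cyclic group this says that one order divides
  the other. Vertices of prime-power order are therefore special: the elements of a cyclic
  \<open>q\<close>-group are pairwise adjacent, so \<open>\<langle>g\<rangle>\<close> is contained in the closure of the N-class of \<open>g\<close>
  whenever \<open>g\<close> has prime-power order (\<open>prime_power_cyclic_subset_nbhd_closure\<close>).
  For a critical class, the closure is only \<open>C \<union> {1}\<close>, which pins \<open>C\<close> down.

  Suppose that \<open>C\<close> is of plain type, so \<open>C\<close> is the set of generators of \<open>\<langle>y\<rangle>\<close>. If the order of \<open>y\<close>
  were a prime power, then \<open>\<langle>y\<rangle> = C \<union> {1}\<close> would have order \<open>p\<^sup>r\<close> with \<open>r \<ge> 2\<close>, and its elements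
  of order \<open>p\<close> would be neither trivial nor generators. So \<open>y\<close> has order \<open>q\<^sup>a t\<close> with \<open>t > 1\<close>
  coprime to the prime \<open>q\<close> and \<open>a \<ge> 1\<close>. An element \<open>x\<close> of \<open>\<langle>y\<rangle>\<close> of order \<open>q\<^sup>a\<close> then has a plain
  N-class (\<open>N_class_of_prime_part_eq_generators\<close>), whose size \<open>\<phi>(q\<^sup>a)\<close> is at most
  \<open>\<phi>(q\<^sup>a t) = |C|\<close>.

  Suppose that \<open>C\<close> is not of plain type, and let \<open>g \<in> C\<close> have maximal order. Two members of \<open>C\<close>
  generating different subgroups force that order to be a prime power \<open>q\<^sup>a\<close>
  (\<open>ord_prime_power_if_same_closed_nbhd\<close>), with \<open>a \<ge> 2\<close>, and hence \<open>C = \<langle>g\<rangle> - {1}\<close>. A neighbour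
  \<open>x\<close> of \<open>y\<close> outside \<open>\<langle>g\<rangle>\<close> satisfies \<open>g \<in> \<langle>x\<rangle>\<close>. The order of \<open>x\<close> is again a power of \<open>q\<close>:
  an element of \<open>\<langle>x\<rangle>\<close> of order \<open>q t\<close> with \<open>t > 1\<close> coprime to \<open>q\<close> would be adjacent to the
  elements of order \<open>q\<close> in \<open>C\<close> but not to \<open>g\<close>. So \<open>x\<close> has order \<open>q\<^sup>b\<close> with \<open>b > a\<close>, and its class
  has at least \<open>\<phi>(q\<^sup>b) \<ge> q\<^sup>b\<^sup>-\<^sup>1 \<ge> q\<^sup>a > |C|\<close> members.
\<close>

section \<open>Cyclic subgroups of a finite group\<close>

lemma (in group) generate_singleton_mono:
  assumes "x \<in> carrier G" "z \<in> generate G {x}"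
  shows "generate G {z} \<subseteq> generate G {x}"
  using assms generate_subgroup_incl[of "{z}" "generate G {x}"] generate_is_subgroup[of "{x}"]
  by simp

lemma (in group) mem_generate_singleton:
  "x \<in> generate G {x}"
  by (simp add: generate.incl)

lemma (in group) generate_singleton_carrier:
  assumes "x \<in> carrier G" "z \<in> generate G {x}"
  shows "z \<in> carrier G"
  using assms generate_in_carrier[of "{x}" z] by simp

lemma (in group) exists_in_cyclic_of_ord:
  assumes "finite (carrier G)" "y \<in> carrier G" "d dvd ord y"
  obtains w where "w \<in> generate G {y}" "w \<in> carrier G" "ord w = d"
proof
  have pos: "ord y > 0" using ord_ge_1[OF assms(1,2)] by simp
  let ?w = "y [^] (ord y div d)"
  show "?w \<in> generate G {y}"
    using generate_pow_on_finite_carrier[OF assms(1,2)] by blast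
  show "?w \<in> carrier G" using assms(2) by simp
  show "ord ?w = d"
    using pos assms by (subst ord_pow) (auto elim!: dvdE)
qed

text \<open>
  The elements of the cyclic group \<open>\<langle>y\<rangle>\<close> whose order divides \<open>d\<close> all lie in the subgroup generated
  by \<open>v = y\<^sup>n\<^sup>/\<^sup>d\<close>, where \<open>n\<close> is the order of \<open>y\<close>. For \<open>d\<close> the order of \<open>w\<close>, this subgroup has the
  same size as \<open>\<langle>w\<rangle>\<close> and contains it, so it is \<open>\<langle>w\<rangle>\<close>. Through this lemma, adjacency in the power
  graph turns into arithmetic of divisors.
\<close>

lemma (in group) mem_generate_iff_ord_dvd:
  assumes fin: "finite (carrier G)" and y: "y \<in> carrier G"
    and z: "z \<in> generate G {y}" and w: "w \<in> generate G {y}"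
  shows "z \<in> generate G {w} \<longleftrightarrow> ord z dvd ord w"
proof -
  have dvd: "ord u dvd ord v" if v: "v \<in> carrier G" and u: "u \<in> generate G {v}" for u v
  proof -
    obtain k :: nat where k: "u = v [^] k"
      using u generate_pow_on_finite_carrier[OF fin v] by blast
    have "u [^] ord v = (v [^] ord v) [^] k"
      using v by (simp only: k nat_pow_pow mult.commute)
    then have "u [^] ord v = \<one>" using v by simp
    then show ?thesis
      using generate_singleton_carrier[OF v u] pow_eq_id by simp
  qed
  have wc: "w \<in> carrier G" using generate_singleton_carrier[OF y w] .
  define d where "d = ord w"
  have d: "d dvd ord y" unfolding d_def using dvd[OF y w] .
  have pos: "ord y > 0" using ord_ge_1[OF fin y] by simp
  define v where "v = y [^] (ord y div d)"
  have vc: "v \<in> carrier G" using y by (simp add: v_def)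
  have ordv: "ord v = d" unfolding v_def
    using pos d y by (subst ord_pow) (auto elim!: dvdE)
  have key: "u \<in> generate G {v}" if u: "u \<in> generate G {y}" and ud: "ord u dvd d" for u
  proof -
    obtain k :: nat where k: "u = y [^] k"
      using u generate_pow_on_finite_carrier[OF fin y] by blast
    have "u [^] d = \<one>"
      using ud generate_singleton_carrier[OF y u] pow_eq_id by simp
    then have "ord y dvd k * d"
      using y by (simp add: k nat_pow_pow pow_eq_id)
    then have "ord y div d dvd k"
      using d pos by (auto elim!: dvdE)
    then obtain j where "k = (ord y div d) * j" by (auto elim: dvdE)
    then have "u = v [^] j" using y by (simp add: k v_def nat_pow_pow)
    then show ?thesis using generate_pow_on_finite_carrier[OF fin vc] by blast
  qed
  have "generate G {w} = generate G {v}"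
  proof (rule card_subset_eq)
    show "finite (generate G {v})"
      using fin generate_incl[of "{v}"] vc by (auto intro: finite_subset)
    show "generate G {w} \<subseteq> generate G {v}"
      by (rule generate_singleton_mono[OF vc key]) (use w in \<open>auto simp: d_def\<close>)
    show "card (generate G {w}) = card (generate G {v})"
      using generate_pow_card[OF wc] generate_pow_card[OF vc] ordv d_def by simp
  qed
  then show ?thesis
    using key[OF z] dvd[OF wc, of z] d_def by blast
qed

lemma (in group) ord_dvd_of_mem_generate:
  assumes "finite (carrier G)" "y \<in> carrier G" "z \<in> generate G {y}"
  shows "ord z dvd ord y"
  using mem_generate_iff_ord_dvd[OF assms(1,2,3) mem_generate_singleton] assms(3) by simp

lemma (in group) generate_eq_iff_ord_eq:
  assumes fin: "finite (carrier G)" and y: "y \<in> carrier G" and z: "z \<in> generate G {y}"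
  shows "generate G {z} = generate G {y} \<longleftrightarrow> ord z = ord y"
proof
  assume "generate G {z} = generate G {y}"
  then show "ord z = ord y"
    using generate_pow_card[OF y]
      generate_pow_card[OF generate_singleton_carrier[OF y z]] by simp
next
  assume "ord z = ord y"
  then have "y \<in> generate G {z}"
    using mem_generate_iff_ord_dvd[OF fin y mem_generate_singleton z] by simp
  then show "generate G {z} = generate G {y}"
    using generate_singleton_mono[OF y z]
      generate_singleton_mono[OF generate_singleton_carrier[OF y z], of y] by blast
qed

lemma (in group) card_generators_eq_totient:
  assumes fin: "finite (carrier G)" and x: "x \<in> carrier G"
  shows "card {z \<in> carrier G. generate G {z} = generate G {x}} = totient (ord x)"
proof -
  have pos: "ord x > 0" using ord_ge_1[OF fin x] by simp
  have ord_pow_x: "ord (x [^] k) = ord x \<longleftrightarrow> coprime k (ord x)" if "k \<in> {1..ord x}" for k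
  proof -
    have "ord (x [^] k) = ord x div gcd (ord x) k"
      using ord_pow_gen[OF x, of k] that by simp
    moreover have "ord x div gcd (ord x) k = ord x \<longleftrightarrow> gcd (ord x) k = 1"
      using pos by (auto simp: div_eq_dividend_iff)
    ultimately show ?thesis by (simp add: coprime_iff_gcd_eq_1 gcd.commute)
  qed
  have gen: "generate G {x} = (\<lambda>k. x [^] k) ` {1..ord x}"
  proof (rule sym, rule card_subset_eq)
    show "finite (generate G {x})"
      using fin generate_incl[of "{x}"] x by (auto intro: finite_subset)
    show "(\<lambda>k. x [^] k) ` {1..ord x} \<subseteq> generate G {x}"
      using generate_pow_on_finite_carrier[OF fin x] by blast
    show "card ((\<lambda>k. x [^] k) ` {1..ord x}) = card (generate G {x})"
      using card_image[OF ord_inj'[OF x]] generate_pow_card[OF x] by simp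
  qed
  have "{z \<in> carrier G. generate G {z} = generate G {x}} = (\<lambda>k. x [^] k) ` totatives (ord x)"
    (is "?L = ?R")
  proof (intro equalityI subsetI)
    fix z assume z: "z \<in> ?L"
    then have zx: "z \<in> generate G {x}" using mem_generate_singleton[of z] by simp
    then obtain k where k: "k \<in> {1..ord x}" "z = x [^] k" using gen by auto
    moreover have "ord z = ord x" using generate_eq_iff_ord_eq[OF fin x zx] z by simp
    ultimately show "z \<in> ?R" using ord_pow_x by (auto simp: in_totatives_iff)
  next
    fix z assume "z \<in> ?R"
    then obtain k where "k \<in> totatives (ord x)" and zk: "z = x [^] k" by blast
    then have k: "k \<in> {1..ord x}" "coprime k (ord x)" by (auto simp: in_totatives_iff)
    have "z \<in> generate G {x}" unfolding zk gen using k(1) by blast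
    moreover have "ord z = ord x" using ord_pow_x[OF k(1)] k(2) zk by simp
    ultimately show "z \<in> ?L"
      using generate_eq_iff_ord_eq[OF fin x] generate_singleton_carrier[OF x] by auto
  qed
  moreover have "inj_on (\<lambda>k. x [^] k) (totatives (ord x))"
    by (rule inj_on_subset[OF ord_inj'[OF x]]) (auto simp: in_totatives_iff)
  ultimately show ?thesis by (simp add: card_image totient_def)
qed

section \<open>The power graph\<close>

lemma (in group) power_graph_edges_iff:
  assumes fin: "finite (carrier G)"
  shows "{x, y} \<in> power_graph_edges G \<longleftrightarrow> x \<in> carrier G \<and> y \<in> carrier G \<and> x \<noteq> y \<and>
    (x \<in> generate G {y} \<or> y \<in> generate G {x})"
proof -
  have pw: "u \<in> generate G {v} \<longleftrightarrow> (\<exists>m::nat. m > 0 \<and> u = v [^] m)" if v: "v \<in> carrier G" for u v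
  proof
    assume "u \<in> generate G {v}"
    then obtain k :: nat where k: "u = v [^] k"
      using generate_pow_on_finite_carrier[OF fin v] by blast
    \<comment> \<open>The exponent 0 is not allowed in the definition of adjacency; adding the order avoids it.\<close>
    have "u = v [^] (k + ord v)" using v by (simp add: k flip: nat_pow_mult)
    moreover have "k + ord v > 0" using ord_ge_1[OF fin v] by simp
    ultimately show "\<exists>m::nat. m > 0 \<and> u = v [^] m" by blast
  qed (use generate_pow_on_finite_carrier[OF fin v] in blast)
  have "{x, y} \<in> power_graph_edges G \<longleftrightarrow> x \<in> carrier G \<and> y \<in> carrier G \<and> x \<noteq> y \<and>
      (\<exists>m::nat. m > 0 \<and> (x = y [^] m \<or> y = x [^] m))"
    unfolding power_graph_edges_def mem_Collect_eq doubleton_eq_iff by metis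
  then show ?thesis using pw[of y x] pw[of x y] by blast
qed

lemma (in group) mem_closed_nbhd_iff:
  assumes "finite (carrier G)" "x \<in> carrier G"
  shows "z \<in> closed_nbhd G x \<longleftrightarrow>
    z \<in> carrier G \<and> (z \<in> generate G {x} \<or> x \<in> generate G {z})"
  using assms mem_generate_singleton[of x]
  by (auto simp: closed_nbhd_def power_graph_edges_iff)

lemma mem_N_class_iff:
  "z \<in> N_class G x \<longleftrightarrow> x \<in> carrier G \<and> z \<in> carrier G \<and> closed_nbhd G x = closed_nbhd G z"
  by (auto simp: N_class_def N_rel_def)

lemma (in group) mem_closed_nbhd_cyclic_iff:
  assumes "finite (carrier G)" "y \<in> carrier G" "z \<in> generate G {y}" "w \<in> generate G {y}"
  shows "z \<in> closed_nbhd G w \<longleftrightarrow> ord z dvd ord w \<or> ord w dvd ord z"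
  using assms mem_generate_iff_ord_dvd[OF assms] mem_generate_iff_ord_dvd[OF assms(1,2,4,3)]
    generate_singleton_carrier[OF assms(2)]
  by (auto simp: mem_closed_nbhd_iff)

lemma (in group) closed_nbhd_cong_generate:
  assumes fin: "finite (carrier G)" and c: "x \<in> carrier G" "z \<in> carrier G"
    and e: "generate G {z} = generate G {x}"
  shows "closed_nbhd G z = closed_nbhd G x"
proof -
  have "z \<in> generate G {u} \<longleftrightarrow> x \<in> generate G {u}" if "u \<in> carrier G" for u
    using generate_singleton_mono[OF that] mem_generate_singleton[of x] mem_generate_singleton[of z] e
    by blast
  then show ?thesis using e by (auto simp: mem_closed_nbhd_iff[OF fin] c)
qed

lemma (in group) generators_subset_N_class:
  assumes "finite (carrier G)" "x \<in> carrier G"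
  shows "{z \<in> carrier G. generate G {z} = generate G {x}} \<subseteq> N_class G x"
  using assms(2) closed_nbhd_cong_generate[OF assms]
  unfolding mem_N_class_iff subset_iff mem_Collect_eq by metis

text \<open>
  Elements with the same cyclic subgroup have the same neighbourhood, so an N-class contains the
  \<open>\<diamond>\<close>-class of each of its members and can only fail to be plain by being larger.
\<close>

lemma (in group) plain_type_N_class_iff:
  assumes fin: "finite (carrier G)" and y: "y \<in> carrier G"
  shows "plain_type G (N_class G y) \<longleftrightarrow> (\<forall>z \<in> N_class G y. generate G {z} = generate G {y})"
proof -
  have q: "N_class G y \<in> carrier G // N_rel G"
    using y by (auto simp: N_class_def quotient_def)
  have yN: "y \<in> N_class G y" using y by (simp add: mem_N_class_iff)
  have d: "diamond_rel G `` {u} = {z \<in> carrier G. generate G {z} = generate G {u}}"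
    if "u \<in> carrier G" for u
    using that by (auto simp: diamond_rel_def)
  show ?thesis
  proof
    assume "plain_type G (N_class G y)"
    then obtain u where "u \<in> carrier G" "N_class G y = diamond_rel G `` {u}"
      by (auto simp: plain_type_def quotient_def)
    then show "\<forall>z \<in> N_class G y. generate G {z} = generate G {y}"
      using yN d by auto
  next
    assume "\<forall>z \<in> N_class G y. generate G {z} = generate G {y}"
    then have "N_class G y = diamond_rel G `` {y}"
      using generators_subset_N_class[OF fin y] d[OF y] by (auto simp: mem_N_class_iff)
    then show "plain_type G (N_class G y)"
      using q y by (auto simp: plain_type_def quotient_def)
  qed
qed

section \<open>Prime power orders and N-classes\<close>

lemma prime_power_split:
  fixes n q :: nat
  assumes "n > 0" "Factorial_Ring.prime q" "q dvd n"
  obtains a t where "n = q ^ a * t" "coprime q t" "a \<ge> 1" "t \<ge> 1"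
proof -
  have nu: "\<not> is_unit q" using assms(2) by (meson not_prime_unit)
  obtain t where t: "n = q ^ multiplicity q n * t" "\<not> q dvd t"
    using multiplicity_decompose'[of n q] nu assms(1) by auto
  show ?thesis
  proof (rule that[OF t(1)])
    show "coprime q t" using t(2) assms(2) prime_imp_coprime by blast
    show "multiplicity q n \<ge> 1"
      using assms nu by (simp add: Suc_leI multiplicity_gt_zero_iff)
    show "t \<ge> 1" using t assms(1) by (cases t) auto
  qed
qed

text \<open>
  Since every element of \<open>\<langle>z\<rangle>\<close> is adjacent to \<open>z\<close>, hence to \<open>x\<close>, the order of \<open>x\<close> is comparable
  under divisibility with every divisor of the order of \<open>z\<close>. A divisor \<open>m\<close> of \<open>n\<close> with
  \<open>1 < m < n\<close> can have this property only if \<open>n\<close> is a prime power.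
\<close>

lemma (in group) ord_prime_power_if_same_closed_nbhd:
  assumes fin: "finite (carrier G)" and z: "z \<in> carrier G" and x: "x \<in> generate G {z}"
    and ne: "ord x \<noteq> ord z" "ord x \<noteq> 1" and N: "closed_nbhd G x = closed_nbhd G z"
  obtains q a where "Factorial_Ring.prime q" "ord z = q ^ a" "a \<ge> 1"
proof -
  note cyc = mem_closed_nbhd_cyclic_iff[OF fin z]
  have posz: "ord z > 0" using ord_ge_1[OF fin z] by simp
  have xz: "ord x dvd ord z" using ord_dvd_of_mem_generate[OF fin z x] .
  have comp: "d dvd ord x \<or> ord x dvd d" if d: "d dvd ord z" for d
  proof -
    obtain w where w: "w \<in> generate G {z}" "w \<in> carrier G" "ord w = d"
      using exists_in_cyclic_of_ord[OF fin z d] .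
    have "w \<in> closed_nbhd G z" using cyc[OF w(1) mem_generate_singleton] w d by simp
    then have "w \<in> closed_nbhd G x" using N by simp
    then show ?thesis using cyc[OF w(1) x] w by simp
  qed
  from xz obtain k where k: "ord z = ord x * k" by (auto elim: dvdE)
  \<comment> \<open>A prime dividing the index of \<open>\<langle>x\<rangle>\<close> in \<open>\<langle>z\<rangle>\<close> has a smaller exponent in the order of \<open>x\<close>.\<close>
  have "k \<noteq> 1" using ne k by simp
  then obtain q where q: "Factorial_Ring.prime q" "q dvd k" using prime_factor_nat by blast
  obtain a t where at: "ord z = q ^ a * t" "coprime q t" "a \<ge> 1" "t \<ge> 1"
    using prime_power_split[OF posz q(1)] q(2) k by (metis dvd_mult)
  have "\<not> q ^ a dvd ord x"
  proof
    assume "q ^ a dvd ord x"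
    then have "q ^ a * q dvd q ^ a * t" using k q(2) at(1) by (metis mult_dvd_mono)
    then have "q dvd t" using q(1) by (simp add: prime_gt_0_nat)
    then show False using at(2) q(1) by (metis coprime_absorb_left not_prime_unit)
  qed
  then have xa: "ord x dvd q ^ a" using comp[of "q ^ a"] at(1) by auto
  have "coprime (q ^ a) t" using at(2) by simp
  then have cx: "coprime (ord x) t" using xa by (metis coprime_divisors dvd_refl)
  have "t = 1"
    using comp[of t] at(1) cx ne(2)
    by (metis coprime_absorb_left coprime_absorb_right dvd_triv_right nat_dvd_1_iff_1)
  then show ?thesis using that q(1) at by simp
qed

text \<open>
  Every \<open>z\<close> with the neighbourhood of \<open>x\<close> must have order \<open>q\<^sup>a\<close>: otherwise \<open>\<langle>y\<rangle>\<close> contains an element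
  adjacent to \<open>z\<close> but not to \<open>x\<close>. It has order \<open>t\<close> if \<open>z\<close> lies above \<open>y\<close>, order \<open>q\<^sup>b t\<close> if \<open>z\<close> has
  order \<open>q\<^sup>b\<close> with \<open>b < a\<close>, and order \<open>s\<close> if \<open>z\<close> has order \<open>q\<^sup>a s\<close> with \<open>s > 1\<close>. Taking the full
  power \<open>q\<^sup>a\<close> matters: elements of \<open>\<langle>y\<rangle>\<close> of order \<open>t\<close> times a smaller power of \<open>q\<close> separate \<open>x\<close>
  from its own powers.
\<close>

lemma (in group) N_class_of_prime_part_eq_generators:
  assumes fin: "finite (carrier G)" and y: "y \<in> carrier G"
    and n: "ord y = q ^ a * t" "Factorial_Ring.prime q" "coprime q t" "t > 1" "a \<ge> 1"
    and x: "x \<in> generate G {y}" "ord x = q ^ a"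
  shows "N_class G x = {z \<in> carrier G. generate G {z} = generate G {x}}"
proof -
  have xc: "x \<in> carrier G" using generate_singleton_carrier[OF y x(1)] .
  note cyc = mem_closed_nbhd_cyclic_iff[OF fin y]
  have q1: "q > 1" using n(2) prime_gt_1_nat by blast
  have cqt: "coprime (q ^ i) t" for i using n(3) by simp
  have "generate G {z} = generate G {x}" if "z \<in> N_class G x" for z
  proof -
    have zc: "z \<in> carrier G" and N: "closed_nbhd G x = closed_nbhd G z"
      using that by (auto simp: mem_N_class_iff)
    have "y \<in> closed_nbhd G x"
      using y x(1) xc by (auto simp: mem_closed_nbhd_iff[OF fin])
    then have yz: "y \<in> generate G {z} \<or> z \<in> generate G {y}"
      using N zc by (auto simp: mem_closed_nbhd_iff[OF fin])
    obtain w where w: "w \<in> generate G {y}" "w \<in> carrier G" "ord w = t"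
      using exists_in_cyclic_of_ord[OF fin y, of t] n(1) by auto
    \<comment> \<open>Orders \<open>q\<^sup>b s\<close> of this shape are incomparable with \<open>q\<^sup>a\<close>; they rule out all cases below.\<close>
    have nadj: "w' \<notin> closed_nbhd G x"
      if "w' \<in> generate G {y}" "ord w' = q ^ b * s" "b < a" "s dvd t" "s > 1" for w' b s
    proof
      assume "w' \<in> closed_nbhd G x"
      then have "q ^ b * s dvd q ^ a \<or> q ^ a dvd q ^ b * s"
        using cyc[OF that(1) x(1)] that x by simp
      then show False
      proof
        assume "q ^ b * s dvd q ^ a"
        then have "s dvd q ^ a" by (metis dvd_mult_right)
        then show False using cqt[of a] that
          by (metis coprime_absorb_left coprime_divisors coprime_commute dvd_refl nat_dvd_1_iff_1 less_irrefl)
      next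
        assume a: "q ^ a dvd q ^ b * s"
        have "coprime (q ^ a) s" using cqt[of a] that by (metis coprime_divisors dvd_refl)
        then have "q ^ a dvd q ^ b" using a by (simp add: coprime_dvd_mult_left_iff)
        then show False using q1 that(3) by (metis power_dvd_imp_le not_le)
      qed
    qed
    have wx: "w \<notin> closed_nbhd G x" using nadj[OF w(1), of 0 t] w n by simp
    have ynz: "y \<notin> generate G {z}"
    proof
      assume "y \<in> generate G {z}"
      then have "w \<in> generate G {z}" using generate_singleton_mono[OF zc] w by blast
      then show False using wx N w zc by (simp add: mem_closed_nbhd_iff[OF fin])
    qed
    with yz have zy: "z \<in> generate G {y}" by simp
    have adj: "ord z dvd q ^ a \<or> q ^ a dvd ord z"
    proof -
      have "x \<in> closed_nbhd G z" using N xc by (auto simp: closed_nbhd_def)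
      then show ?thesis using cyc[OF x(1) zy] x by auto
    qed
    have "ord z = q ^ a"
    proof (rule ccontr)
      assume ne: "ord z \<noteq> q ^ a"
      from adj show False
      proof
        assume "ord z dvd q ^ a"
        then obtain b where b: "ord z = q ^ b" "b \<le> a" using divides_primepow_nat[OF n(2)] by auto
        then have ba: "b < a" using ne by (metis le_neq_implies_less)
        have "q ^ b * t dvd ord y" using n(1) b by (simp add: le_imp_power_dvd mult_dvd_mono)
        then obtain u where u: "u \<in> generate G {y}" "u \<in> carrier G" "ord u = q ^ b * t"
          using exists_in_cyclic_of_ord[OF fin y] by blast
        have "u \<in> closed_nbhd G z" using cyc[OF u(1) zy] u b by simp
        then show False using nadj[OF u(1) u(3) ba] n N by simp
      next
        assume "q ^ a dvd ord z"
        then obtain s where s: "ord z = q ^ a * s" by (auto elim: dvdE)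
        have "q ^ a * s dvd q ^ a * t" using ord_dvd_of_mem_generate[OF fin y zy] s n(1) by simp
        then have st: "s dvd t" using q1 by simp
        have "s \<noteq> 0" using st n by (metis dvd_0_left_iff not_less0)
        moreover have "s \<noteq> 1" using s ne by simp
        ultimately have s1: "s > 1" by simp
        have "s dvd ord y" using st n(1) by simp
        then obtain u where u: "u \<in> generate G {y}" "u \<in> carrier G" "ord u = s"
          using exists_in_cyclic_of_ord[OF fin y] by blast
        have "u \<in> closed_nbhd G z" using cyc[OF u(1) zy] u s by simp
        then show False using nadj[OF u(1), of 0 s] u n N st s1 by simp
      qed
    qed
    then have "ord z = ord x" using x by simp
    then have "z \<in> generate G {x}" using mem_generate_iff_ord_dvd[OF fin y zy x(1)] by simp
    then show ?thesis using generate_eq_iff_ord_eq[OF fin xc] \<open>ord z = ord x\<close> by simp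
  qed
  moreover have "N_class G x \<subseteq> carrier G" by (auto simp: mem_N_class_iff)
  ultimately show ?thesis using generators_subset_N_class[OF fin xc] by blast
qed

text \<open>
  A neighbour of \<open>y\<close> either lies in \<open>\<langle>y\<rangle>\<close>, where divisors of a prime power are comparable, or
  generates a group that contains \<open>\<langle>y\<rangle>\<close>. In both cases it is adjacent to all of \<open>\<langle>y\<rangle>\<close>.
\<close>

lemma (in group) prime_power_cyclic_subset_nbhd_closure:
  assumes fin: "finite (carrier G)" and y: "y \<in> carrier G"
    and pp: "Factorial_Ring.prime q" "ord y = q ^ a"
  shows "generate G {y} \<subseteq> nbhd_closure G (N_class G y)"
proof -
  have "common_closed_nbhd G (N_class G y) = closed_nbhd G y"
    using y by (auto simp: common_closed_nbhd_def mem_N_class_iff)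
  moreover have "z \<in> closed_nbhd G w" if z: "z \<in> generate G {y}" and w: "w \<in> closed_nbhd G y" for z w
  proof (cases "w \<in> generate G {y}")
    case True
    obtain i j where "ord z = q ^ i" "ord w = q ^ j"
      using ord_dvd_of_mem_generate[OF fin y] z True pp divides_primepow_nat[OF pp(1)] by metis
    then show ?thesis using mem_closed_nbhd_cyclic_iff[OF fin y z True]
      by (metis le_imp_power_dvd nat_le_linear)
  next
    case False
    then have "w \<in> carrier G" "y \<in> generate G {w}" using w mem_closed_nbhd_iff[OF fin y] by auto
    then show ?thesis
      using z generate_singleton_mono[of w y] generate_singleton_carrier[OF y z]
      by (auto simp: mem_closed_nbhd_iff[OF fin])
  qed
  moreover have "y \<in> closed_nbhd G y" by (simp add: closed_nbhd_def)
  ultimately show ?thesis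
    using y by (auto simp: nbhd_closure_def common_closed_nbhd_def)
qed

section \<open>Critical classes\<close>

text \<open>
  The order of \<open>y\<close> is not a prime power, because the closure has prime-power size with exponent at
  least 2. The neighbour is an element of \<open>\<langle>y\<rangle>\<close> that generates a Sylow subgroup of \<open>\<langle>y\<rangle>\<close>.
\<close>

lemma (in group) plain_critical_class_has_small_neighbour:
  assumes fin: "finite (carrier G)" and y: "y \<in> carrier G"
    and crit: "critical_class G (N_class G y)" and plain: "plain_type G (N_class G y)"
  shows "\<exists>x \<in> carrier G - nbhd_closure G (N_class G y).
    card (N_class G x) \<le> card (N_class G y) \<and> {x, y} \<in> power_graph_edges G"
proof -
  let ?C = "N_class G y"
  have "?C \<subseteq> carrier G" by (auto simp: mem_N_class_iff)
  then have C: "?C = {z \<in> carrier G. generate G {z} = generate G {y}}"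
    using plain plain_type_N_class_iff[OF fin y] generators_subset_N_class[OF fin y] by blast
  have ordC: "ord z = ord y" if "z \<in> ?C" for z
    using that C generate_pow_card[of z] generate_pow_card[OF y] by simp
  have one: "\<one> \<notin> ?C" and cl: "nbhd_closure G ?C = ?C \<union> {\<one>}"
    and "\<exists>(p::nat) (r::nat). Factorial_Ring.prime p \<and> r \<ge> 2 \<and> card (nbhd_closure G ?C) = p ^ r"
    using crit unfolding critical_class_def by blast+
  then obtain p r :: nat where pr: "Factorial_Ring.prime p" "r \<ge> 2" "card (nbhd_closure G ?C) = p ^ r"
    by blast
  have yC: "y \<in> ?C" using y by (simp add: mem_N_class_iff)
  have pos: "ord y > 0" using ord_ge_1[OF fin y] by simp
  have "ord y \<noteq> 1" using ord_eq_1[OF y] one yC by auto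
  then obtain q where q: "Factorial_Ring.prime q" "q dvd ord y" using prime_factor_nat by blast
  obtain a t where at: "ord y = q ^ a * t" "coprime q t" "a \<ge> 1" "t \<ge> 1"
    using prime_power_split[OF pos q] .
  have t1: "t > 1"
  proof (rule ccontr)
    assume "\<not> t > 1"
    then have oy: "ord y = q ^ a" using at by simp
    have "?C \<subseteq> generate G {y}" using C mem_generate_singleton by blast
    then have "nbhd_closure G ?C = generate G {y}"
      using prime_power_cyclic_subset_nbhd_closure[OF fin y q(1) oy] cl generate.one[of G "{y}"] by blast
    then have opr: "ord y = p ^ r" using pr(3) generate_pow_card[OF y] by simp
    \<comment> \<open>An element of order \<open>p\<close> is neither trivial nor, as \<open>r \<ge> 2\<close>, a generator.\<close>
    obtain w where w: "w \<in> generate G {y}" "w \<in> carrier G" "ord w = p"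
      using exists_in_cyclic_of_ord[OF fin y, of p] opr pr(2) by (auto simp: dvd_power)
    have "w \<in> ?C \<union> {\<one>}" using w cl \<open>nbhd_closure G ?C = generate G {y}\<close> by simp
    moreover have "p > 1" using pr(1) prime_gt_1_nat by blast
    moreover have "p \<noteq> p ^ r" using pr(2) \<open>p > 1\<close> power_inject_exp[of p 1 r] by auto
    ultimately show False using ordC[of w] w opr by auto
  qed
  obtain x where x: "x \<in> generate G {y}" "x \<in> carrier G" "ord x = q ^ a"
    using exists_in_cyclic_of_ord[OF fin y, of "q ^ a"] at(1) by auto
  have ne: "ord x \<noteq> ord y" using x at t1 pos by simp
  have "x \<noteq> \<one>"
  proof
    assume "x = \<one>"
    then have "q ^ a = 1" using x by simp
    then show False using at(3) prime_gt_1_nat[OF q(1)] by (simp add: power_eq_1_iff)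
  qed
  then have "x \<notin> nbhd_closure G ?C" using cl ordC ne by auto
  moreover have "{x, y} \<in> power_graph_edges G"
    using x y ne by (auto simp: power_graph_edges_iff[OF fin])
  moreover have "card (N_class G x) \<le> card ?C"
  proof -
    have "card (N_class G x) = totient (q ^ a)"
      using N_class_of_prime_part_eq_generators[OF fin y at(1) q(1) at(2) t1 at(3) x(1,3)]
        card_generators_eq_totient[OF fin x(2)] x by simp
    also have "\<dots> \<le> totient (ord y)" using pos at(1) by (intro totient_dvd_mono) auto
    also have "\<dots> = card ?C" using C card_generators_eq_totient[OF fin y] by simp
    finally show ?thesis .
  qed
  ultimately show ?thesis using x by blast
qed

text \<open>
  Here \<open>C\<close> consists of the nontrivial elements of a cyclic group of order \<open>q\<^sup>a\<close> with \<open>a \<ge> 2\<close>, so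
  elements of order \<open>q\<close> have the same neighbours as those of order \<open>q\<^sup>a\<close>. This confines the outer
  neighbours of \<open>C\<close> to elements of order \<open>q\<^sup>b\<close> with \<open>b > a\<close>, and the cyclic group of such an
  element has more generators than \<open>C\<close> has members.
\<close>

lemma (in group) compound_critical_class_has_no_small_neighbour:
  assumes fin: "finite (carrier G)" and y: "y \<in> carrier G"
    and crit: "critical_class G (N_class G y)" and compound: "\<not> plain_type G (N_class G y)"
    and x: "x \<in> carrier G - nbhd_closure G (N_class G y)" and e: "{x, y} \<in> power_graph_edges G"
  shows "card (N_class G y) < card (N_class G x)"
proof -
  let ?C = "N_class G y"
  have one: "\<one> \<notin> ?C" and cl: "nbhd_closure G ?C = ?C \<union> {\<one>}"
    using crit by (auto simp: critical_class_def)
  have yC: "y \<in> ?C" using y by (simp add: mem_N_class_iff)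
  have Cc: "?C \<subseteq> carrier G" by (auto simp: mem_N_class_iff)
  have finC: "finite ?C" using Cc fin finite_subset by blast
  have Nz: "closed_nbhd G z = closed_nbhd G y" if "z \<in> ?C" for z
    using that by (simp add: mem_N_class_iff)
  obtain g where g: "g \<in> ?C" and gmax: "\<And>z. z \<in> ?C \<Longrightarrow> ord z \<le> ord g"
    using finC yC Max_in[of "ord ` ?C"] Max_ge[of "ord ` ?C"]
    by (smt (verit, best) empty_iff finite_imageI imageE image_eqI image_is_empty)
  have gc: "g \<in> carrier G" using g Cc by blast
  have gC: "N_class G g = ?C" using g y gc by (auto simp: mem_N_class_iff)
  have Cg: "z \<in> generate G {g}" if z: "z \<in> ?C" for z
  proof -
    have zc: "z \<in> carrier G" using z Cc by blast
    have "z \<in> closed_nbhd G g" using Nz[OF z] Nz[OF g] by (auto simp: closed_nbhd_def)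
    moreover have "z \<in> generate G {g}" if gz: "g \<in> generate G {z}"
    proof -
      have "ord z = ord g" using gmax[OF z] ord_dvd_of_mem_generate[OF fin zc gz]
          ord_ge_1[OF fin zc] by (simp add: dvd_imp_le le_antisym)
      then show ?thesis
        using generate_eq_iff_ord_eq[OF fin zc gz] mem_generate_singleton[of z] by simp
    qed
    ultimately show ?thesis using mem_closed_nbhd_iff[OF fin gc] by blast
  qed
  obtain v where v: "v \<in> ?C" "generate G {v} \<noteq> generate G {g}"
    using compound plain_type_N_class_iff[OF fin gc] gC by auto
  have vne: "ord v \<noteq> ord g" using v generate_eq_iff_ord_eq[OF fin gc Cg] by blast
  have v1: "ord v \<noteq> 1" using v one Cc ord_eq_1 by blast
  obtain q a where q: "Factorial_Ring.prime q" "ord g = q ^ a" "a \<ge> 1"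
    using ord_prime_power_if_same_closed_nbhd[OF fin gc Cg[OF v(1)] vne v1] Nz v g by metis
  have q1: "q > 1" using q(1) prime_gt_1_nat by blast
  obtain i where i: "i \<le> a" "ord v = q ^ i"
    using ord_dvd_of_mem_generate[OF fin gc Cg[OF v(1)]] q divides_primepow_nat[OF q(1)] by auto
  have "i \<noteq> 0" "i \<noteq> a" using i v1 vne q by auto
  then have a2: "a \<ge> 2" using i by simp
  have gen: "generate G {g} = ?C \<union> {\<one>}"
    using prime_power_cyclic_subset_nbhd_closure[OF fin gc q(1,2)] gC cl Cg generate.one[of G "{g}"] by auto
  have cardC: "card ?C < q ^ a"
    using generate_pow_card[OF gc] gen one finC q by simp
  have xc: "x \<in> carrier G" and xn: "x \<notin> generate G {g}" using x cl gen by auto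
  have "x \<in> closed_nbhd G y"
    using e xc power_graph_edges_iff[OF fin] mem_closed_nbhd_iff[OF fin y] by auto
  then have gx: "g \<in> generate G {x}"
    using Nz[OF g] xn mem_closed_nbhd_iff[OF fin gc] by auto
  have posx: "ord x > 0" using ord_ge_1[OF fin xc] by simp
  have gxd: "q ^ a dvd ord x" using ord_dvd_of_mem_generate[OF fin xc gx] q by simp
  then have "q dvd ord x" using q(3) by (metis dvd_power dvd_trans less_le_trans zero_less_one)
  then obtain b t where bt: "ord x = q ^ b * t" "coprime q t" "b \<ge> 1" "t \<ge> 1"
    using prime_power_split[OF posx q(1)] by blast
  have "t = 1"
  proof (rule ccontr)
    assume t1: "t \<noteq> 1"
    obtain u where u: "u \<in> generate G {g}" "u \<in> carrier G" "ord u = q"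
      using exists_in_cyclic_of_ord[OF fin gc, of q] q by (auto simp: dvd_power)
    have "u \<noteq> \<one>" using u q1 by auto
    then have uC: "u \<in> ?C" using gen u by auto
    \<comment> \<open>Order \<open>q t\<close> is comparable with \<open>q\<close> but not with \<open>q\<^sup>a\<close>, as \<open>a \<ge> 2\<close> and \<open>t > 1\<close>.\<close>
    have "q * t dvd ord x" using bt by (simp add: dvd_power mult_dvd_mono)
    then obtain w where w: "w \<in> generate G {x}" "w \<in> carrier G" "ord w = q * t"
      using exists_in_cyclic_of_ord[OF fin xc] by blast
    have ux: "u \<in> generate G {x}" using generate_singleton_mono[OF xc gx] u by blast
    have "w \<in> closed_nbhd G u"
      using mem_closed_nbhd_cyclic_iff[OF fin xc w(1) ux] w u by simp
    then have "w \<in> closed_nbhd G g" using Nz[OF uC] Nz[OF g] by simp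
    then have "q * t dvd q ^ a \<or> q ^ a dvd q * t"
      using mem_closed_nbhd_cyclic_iff[OF fin xc w(1) gx] w q by simp
    then show False
    proof
      assume "q * t dvd q ^ a"
      then have "t dvd q ^ a" by (metis dvd_mult_right)
      moreover have "coprime t (q ^ a)" using bt(2) by (simp add: coprime_commute)
      ultimately show False using t1 by (metis coprime_absorb_left nat_dvd_1_iff_1)
    next
      assume "q ^ a dvd q * t"
      moreover have "coprime (q ^ a) t" using bt(2) by simp
      ultimately have "q ^ a dvd q ^ 1" by (simp add: coprime_dvd_mult_left_iff)
      then show False using q1 a2 by (metis power_dvd_imp_le not_less_eq_eq numeral_2_eq_2 One_nat_def)
    qed
  qed
  then have ox: "ord x = q ^ b" using bt by simp
  have "a \<le> b" using gxd ox q1 power_dvd_imp_le by metis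
  moreover have "a \<noteq> b"
    using generate_eq_iff_ord_eq[OF fin xc gx] ox q xn mem_generate_singleton[of x] by auto
  ultimately have ab: "a \<le> b - 1" by simp
  have "q ^ a \<le> q ^ (b - 1)" using ab q1 by (simp add: power_increasing)
  also have "\<dots> \<le> totient (q ^ b)" using totient_prime_power[OF q(1), of b] bt(3) q1 by simp
  also have "\<dots> \<le> card (N_class G x)"
  proof -
    have "finite (N_class G x)"
      using fin by (rule rev_finite_subset) (auto simp: mem_N_class_iff)
    then show ?thesis
      using card_mono[OF _ generators_subset_N_class[OF fin xc]]
        card_generators_eq_totient[OF fin xc] ox by simp
  qed
  finally show ?thesis using cardC by simp
qed

theorem proposition19:
  fixes G :: "('a, 'b) monoid_scheme" and y :: 'a and C :: "'a set"
  assumes "group G" and "finite (carrier G)"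
    and "star_vertices G = {\<one>\<^bsub>G\<^esub>}"
    and "y \<in> carrier G" and "C = N_class G y" and "critical_class G C"
  shows "plain_type G C \<longleftrightarrow>
    (\<exists>x \<in> carrier G - nbhd_closure G C.
       card (N_class G x) \<le> card C \<and> {x, y} \<in> power_graph_edges G)"
proof -
  interpret group G by fact
  show ?thesis
    using plain_critical_class_has_small_neighbour[OF assms(2,4)]
      compound_critical_class_has_no_small_neighbour[OF assms(2,4)] assms(5,6)
    by (metis not_le)
qed

end
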